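(* Let $U$ be a countable set. For any collection $\mathcal S$ (not necessarily countable) of random variables taking values in $U$, there exists a coupling of the variables in $\mathcal S$ such that, for any $X,Y\in\mathcal S$, $$\mathbb P(X=Y)=\sum_{u\in U}\left(\sum_{v\in U}\max\left(\frac{\mathbb P(X=v)}{\mathbb P(X=u)},\frac{\mathbb P(Y=v)}{\mathbb P(Y=u)}\right)\right)^{-1}.$$ Moreover, the right-hand side is at least $1-F(d_{\mathrm{TV}}(X,Y))$, where $F(t)=\frac{2t}{1+t}$.
   Context: A coupling of a collection of random variables $(X_i)_{i\in I}$ is a family $(X_i')_{i\in I}$ of random variables on one common probability space such that each $X_i'$ has the same law as $X_i$; primes are omitted, so that $\mathbb P(X=Y)$ on the left-hand side is computed in the coupling. The total variation distance is $d_{\mathrm{TV}}(X,Y)=\sup_A|\mathbb P(X\in A)-\mathbb P(Y\in A)|$, over all measurable sets $A$. Convention: in the displayed sum, the term indexed by $u$ is interpreted as $0$ whenever $\mathbb P(X=u)=0$ or $\mathbb P(Y=u)=0$ (a positive number divided by $0$ is $+\infty$, and $1/\infty=0$). *)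

theory Defs
  imports "HOL-Probability.Probability"
begin

(* The given random variables may live on different probability spaces M i; the
   coupled ones live on the single space N. *)
definition is_coupling ::
  "'i set \<Rightarrow> 'u measure \<Rightarrow> ('i \<Rightarrow> 'a measure) \<Rightarrow> ('i \<Rightarrow> 'a \<Rightarrow> 'u) \<Rightarrow>
    'b measure \<Rightarrow> ('i \<Rightarrow> 'b \<Rightarrow> 'u) \<Rightarrow> bool" where
  "is_coupling I S M X N X' \<longleftrightarrow>
     prob_space N \<and>
     (\<forall>i\<in>I. X' i \<in> N \<rightarrow>\<^sub>M S \<and> distr N S (X' i) = distr (M i) S (X i))"

definition tv_dist ::
  "'u measure \<Rightarrow> 'a measure \<Rightarrow> ('a \<Rightarrow> 'u) \<Rightarrow> 'b measure \<Rightarrow> ('b \<Rightarrow> 'u) \<Rightarrow> real" where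
  "tv_dist S M X N Y =
     (SUP A\<in>sets S. \<bar>\<P>(\<omega> in M. X \<omega> \<in> A) - \<P>(\<omega> in N. Y \<omega> \<in> A)\<bar>)"

(* Here p u = P(X = u) and q u = P(Y = u).  The case distinction is the convention
   "positive / 0 = infinity, 1 / infinity = 0"; division in real would give x / 0 = 0. *)
definition agreement_term :: "'u set \<Rightarrow> ('u \<Rightarrow> real) \<Rightarrow> ('u \<Rightarrow> real) \<Rightarrow> 'u \<Rightarrow> real" where
  "agreement_term U p q u =
     (if p u = 0 \<or> q u = 0 then 0
      else inverse (\<Sum>\<^sub>\<infinity>v\<in>U. max (p v / p u) (q v / q u)))"

definition agreement_sum ::
  "'u set \<Rightarrow> 'a measure \<Rightarrow> ('a \<Rightarrow> 'u) \<Rightarrow> 'b measure \<Rightarrow> ('b \<Rightarrow> 'u) \<Rightarrow> real" where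
  "agreement_sum U M X N Y =
     (\<Sum>\<^sub>\<infinity>u\<in>U. agreement_term U (\<lambda>v. \<P>(\<omega> in M. X \<omega> = v)) (\<lambda>v. \<P>(\<omega> in N. Y \<omega> = v)) u)"

definition F_bound :: "real \<Rightarrow> real" where
  "F_bound t = 2 * t / (1 + t)"

(* infsum is 0 on non-summable families; the next three lemmas show that this default
   is never used in agreement_sum. *)

lemma summable_on_point_probabilities:
  assumes "prob_space M" and X: "X \<in> M \<rightarrow>\<^sub>M count_space U"
  shows "(\<lambda>v. \<P>(\<omega> in M. X \<omega> = v)) summable_on U"
proof (rule nonneg_bdd_above_summable_on)
  interpret prob_space M by fact
  have meas: "{\<omega>\<in>space M. X \<omega> = v} \<in> sets M" if "v \<in> U" for v
  proof -
    have "{\<omega>\<in>space M. X \<omega> = v} = X -` {v} \<inter> space M" by auto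
    then show ?thesis using measurable_sets[OF X, of "{v}"] that by simp
  qed
  have "(\<Sum>v\<in>B. \<P>(\<omega> in M. X \<omega> = v)) \<le> 1" if "B \<subseteq> U" "finite B" for B
  proof -
    have "(\<Sum>v\<in>B. \<P>(\<omega> in M. X \<omega> = v)) = prob (\<Union>v\<in>B. {\<omega>\<in>space M. X \<omega> = v})"
      using that meas
      by (intro finite_measure_finite_Union[symmetric]) (auto simp: disjoint_family_on_def)
    then show ?thesis by simp
  qed
  then show "bdd_above (sum (\<lambda>v. \<P>(\<omega> in M. X \<omega> = v)) ` {B. B \<subseteq> U \<and> finite B})"
    by (intro bdd_aboveI[of _ 1]) auto
qed auto

lemma summable_on_max_ratio:
  fixes p q :: "'u \<Rightarrow> real"
  assumes "p summable_on U" "q summable_on U" "\<And>v. p v \<ge> 0" "\<And>v. q v \<ge> 0"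
  shows "(\<lambda>v. max (p v / p u) (q v / q u)) summable_on U"
proof (rule summable_on_comparison_test)
  show "(\<lambda>v. p v / p u + q v / q u) summable_on U"
    unfolding divide_inverse
    by (intro summable_on_add summable_on_cmult_left assms)
qed (use assms in \<open>auto simp: max_def\<close>)

lemma summable_on_agreement_term:
  fixes p q :: "'u \<Rightarrow> real"
  assumes p: "p summable_on U" and "q summable_on U" "\<And>v. p v \<ge> 0" "\<And>v. q v \<ge> 0"
  shows "agreement_term U p q summable_on U"
proof (rule summable_on_comparison_test)
  define c where "c = infsum p U"
  note s = summable_on_max_ratio[OF assms]
  show "(\<lambda>u. p u * inverse c) summable_on U"
    by (intro summable_on_cmult_left p)
  have "c \<ge> 0" unfolding c_def using assms(3) by (intro infsum_nonneg)
  show "agreement_term U p q u \<le> p u * inverse c" if "u \<in> U" for u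
  proof (cases "p u = 0 \<or> q u = 0")
    case False
    then have pos: "p u > 0" using assms(3)[of u] by simp
    have "infsum p {u} \<le> c"
      unfolding c_def using that assms(3) p by (intro infsum_mono2) auto
    then have "c > 0" using pos by simp
    have "((\<lambda>v. p v / p u) has_sum c / p u) U"
      unfolding divide_inverse c_def by (intro has_sum_cmult_left has_sum_infsum p)
    then have "c / p u \<le> (\<Sum>\<^sub>\<infinity>v\<in>U. max (p v / p u) (q v / q u))"
      by (rule has_sum_mono[OF _ has_sum_infsum[OF s]]) simp
    then have "inverse (\<Sum>\<^sub>\<infinity>v\<in>U. max (p v / p u) (q v / q u)) \<le> inverse (c / p u)"
      using pos \<open>c > 0\<close> by (intro le_imp_inverse_le) auto
    then show ?thesis using False by (simp add: agreement_term_def divide_inverse mult.commute)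
  qed (use assms \<open>c \<ge> 0\<close> in \<open>auto simp: agreement_term_def\<close>)
  show "0 \<le> agreement_term U p q u" for u
    using assms(3,4) by (auto simp: agreement_term_def le_max_iff_disj intro!: infsum_nonneg)
qed

end

theory Submission
  imports Defs
begin

text \<open>
  Give every \<open>u \<in> U\<close> an independent standard exponential variable \<open>E u\<close>, and let the variable with
  point probabilities \<open>p\<close> take the value \<open>u\<close> that minimises \<open>E u / p u\<close>; all variables of the
  collection use the same \<open>E\<close>. The variables with point probabilities \<open>p\<close> and \<open>q\<close> are both equal to
  \<open>u\<close> iff \<open>E v > m v * E u\<close> for all \<open>v \<noteq> u\<close>, where \<open>m v = max (p v / p u) (q v / q u)\<close>. Conditioning
  on \<open>E u\<close>, this has probability \<open>1 / (1 + (\<Sum>v\<noteq>u. m v)) = 1 / (\<Sum>v. m v)\<close>. The case \<open>p = q\<close> gives the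
  marginals, and summation over \<open>u\<close> gives the probability of agreement.
\<close>

section \<open>Countable additivity as unordered sums\<close>

lemma has_sum_diff:
  fixes f g :: "'a \<Rightarrow> 'b::topological_ab_group_add"
  assumes "(f has_sum a) A" "(g has_sum b) A"
  shows "((\<lambda>x. f x - g x) has_sum (a - b)) A"
  using has_sum_add[OF assms(1), of "\<lambda>x. - g x" "- b"] assms(2) by (simp add: has_sum_uminus)

lemma (in finite_measure) has_sum_measure_disjoint_UN:
  assumes "countable K" and A: "\<And>k. k \<in> K \<Longrightarrow> A k \<in> sets M"
    and disj: "disjoint_family_on A K"
  shows "((\<lambda>k. measure M (A k)) has_sum measure M (\<Union>k\<in>K. A k)) K"
proof -
  let ?h = "to_nat_on K" and ?g = "from_nat_into K"
  \<comment> \<open>Transport along the enumeration of \<open>K\<close>: numbers that encode no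
    element of \<open>K\<close> get the empty set, so that finite and infinite \<open>K\<close> are
    treated alike.\<close>
  define B where "B n = (if n \<in> ?h ` K then A (?g n) else {})" for n
  have inj: "inj_on ?h K" using assms(1) by (rule inj_on_to_nat_on)
  have gh: "?g (?h k) = k" if "k \<in> K" for k using that assms(1) by simp
  have sets: "range B \<subseteq> sets M"
    using A gh by (auto simp: B_def)
  have "disjoint_family B"
    using disj gh unfolding disjoint_family_on_def B_def by (auto split: if_splits) (metis disjoint_iff)
  then have "(\<lambda>n. measure M (B n)) sums measure M (\<Union>n. B n)"
    by (intro finite_measure_UNION sets)
  then have "((\<lambda>n. measure M (B n)) has_sum measure M (\<Union>n. B n)) UNIV"
    by (intro sums_nonneg_imp_has_sum) auto
  also have "?this \<longleftrightarrow> ((\<lambda>n. measure M (B n)) has_sum measure M (\<Union>n. B n)) (?h ` K)"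
    by (intro has_sum_cong_neutral) (auto simp: B_def)
  also have "\<dots> \<longleftrightarrow> (((\<lambda>n. measure M (B n)) \<circ> ?h) has_sum measure M (\<Union>n. B n)) K"
    by (intro has_sum_reindex inj)
  also have "\<dots> \<longleftrightarrow> ((\<lambda>k. measure M (A k)) has_sum measure M (\<Union>n. B n)) K"
    by (intro has_sum_cong) (simp add: B_def gh)
  also have "(\<Union>n. B n) = (\<Union>k\<in>K. A k)"
    using gh by (fastforce simp: B_def split: if_splits)
  finally show ?thesis .
qed

text \<open>With \<open>A = U\<close> this gives total mass 1 to the point probabilities; with
  smaller \<open>A\<close> it gives the probabilities of events that the total variation distance
  compares.\<close>

lemma has_sum_point_probabilities:
  assumes "prob_space M" and X: "X \<in> M \<rightarrow>\<^sub>M count_space U"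
    and "A \<subseteq> U" "countable A"
  shows "((\<lambda>v. \<P>(\<omega> in M. X \<omega> = v)) has_sum \<P>(\<omega> in M. X \<omega> \<in> A)) A"
proof -
  interpret prob_space M by fact
  have "((\<lambda>v. prob {\<omega>\<in>space M. X \<omega> = v}) has_sum prob (\<Union>v\<in>A. {\<omega>\<in>space M. X \<omega> = v})) A"
  proof (rule has_sum_measure_disjoint_UN)
    fix v assume "v \<in> A"
    moreover have "{\<omega>\<in>space M. X \<omega> = v} = X -` {v} \<inter> space M" by auto
    ultimately show "{\<omega>\<in>space M. X \<omega> = v} \<in> sets M"
      using measurable_sets[OF X, of "{v}"] assms(3) by auto
  qed (use assms in \<open>auto simp: disjoint_family_on_def\<close>)
  also have "(\<Union>v\<in>A. {\<omega>\<in>space M. X \<omega> = v}) = {\<omega>\<in>space M. X \<omega> \<in> A}" by auto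
  finally show ?thesis .
qed

section \<open>Independent exponential clocks indexed by \<open>U\<close>\<close>

abbreviation exponential_clocks :: "'u set \<Rightarrow> ('u \<Rightarrow> real) measure" where
  "exponential_clocks U \<equiv> \<Pi>\<^sub>M _\<in>U. density lborel (exponential_density 1)"

interpretation exponential: prob_space "density lborel (exponential_density 1)"
  by (rule prob_space_exponential_density) simp

interpretation exponential_clocks: product_prob_space "\<lambda>_. density lborel (exponential_density 1)" U
  for U :: "'u set"
  by unfold_locales

lemma emeasure_exponential_greaterThan:
  assumes "a \<ge> 0"
  shows "emeasure (density lborel (exponential_density 1)) {a<..} = ennreal (exp (- a))"
proof -
  have "distributed (density lborel (exponential_density 1)) lborel (\<lambda>x. x) (exponential_density 1)"
    by (auto simp: distributed_def distr_id2 intro!: exponential_density_nonneg)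
  from exponential.exponential_distributedD_gt[OF this assms] show ?thesis
    by (simp add: exponential.emeasure_eq_measure greaterThan_def)
qed

text \<open>The complement is a countable union of closed comparisons of two coordinates. The factor
  \<open>b\<close> covers both forms of the race: \<open>b = 1\<close> for ratios of rates, and
  \<open>b = p u\<close> for the inequalities after multiplying out.\<close>

lemma sets_clock_comparison:
  assumes J: "countable J" "J \<subseteq> U" and u: "u \<in> U"
  shows "{\<omega> \<in> space (exponential_clocks U). \<forall>v\<in>J. a v * \<omega> u < b * \<omega> v}
    \<in> sets (exponential_clocks U)"
proof -
  let ?Q = "exponential_clocks U"
  have clock: "(\<lambda>\<omega>. \<omega> v) \<in> borel_measurable ?Q" if "v \<in> U" for v
    using measurable_component_singleton[OF that, of "\<lambda>_. density lborel (exponential_density 1)"]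
    by simp
  have "{\<omega> \<in> space ?Q. \<forall>v\<in>J. a v * \<omega> u < b * \<omega> v} =
      space ?Q - (\<Union>v\<in>J. {\<omega> \<in> space ?Q. b * \<omega> v \<le> a v * \<omega> u})"
    by (auto simp: not_le)
  also have "\<dots> \<in> sets ?Q"
    using J u by (intro sets.Diff sets.top sets.countable_UN'' borel_measurable_le
        borel_measurable_times borel_measurable_const clock) auto
  finally show ?thesis .
qed

subsection \<open>The first of countably many exponential clocks\<close>

text \<open>Fubini with the clock of \<open>u\<close> as outer variable: if it shows
  \<open>y\<close>, the others survive with probability \<open>exp (- (m v * y))\<close> each, and
  integrating \<open>exp (- y * (1 + (\<Sum>v\<in>J. m v)))\<close> over \<open>y \<ge> 0\<close>
  gives the inverse of the total rate.\<close>

lemma emeasure_first_clock_finite: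
  fixes m :: "'u \<Rightarrow> real"
  assumes J: "finite J" "u \<notin> J" and m: "\<And>v. v \<in> J \<Longrightarrow> m v \<ge> 0"
  shows "emeasure (exponential_clocks (insert u J))
           {\<omega> \<in> space (exponential_clocks (insert u J)). \<forall>v\<in>J. m v * \<omega> u < \<omega> v}
         = ennreal (inverse (1 + (\<Sum>v\<in>J. m v)))"
proof -
  let ?E = "density lborel (exponential_density 1)" and ?s = "1 + (\<Sum>v\<in>J. m v)"
  let ?A = "{\<omega> \<in> space (exponential_clocks (insert u J)). \<forall>v\<in>J. m v * \<omega> u < \<omega> v}"
  have s: "?s > 0" using m by (simp add: add_pos_nonneg sum_nonneg)
  have [measurable]: "?A \<in> sets (exponential_clocks (insert u J))"
    using J(1) by measurable
  have inner: "(\<integral>\<^sup>+ x. indicator ?A (x(u := y)) \<partial>exponential_clocks J)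
      = ennreal (exp (- (y * (\<Sum>v\<in>J. m v))))" if "y \<ge> 0" for y
  proof -
    \<comment> \<open>With the coordinate \<open>u\<close> fixed at \<open>y\<close>, the event is a
      box in the remaining coordinates, so independence turns its measure into a product of
      exponential tails.\<close>
    have "(\<integral>\<^sup>+ x. indicator ?A (x(u := y)) \<partial>exponential_clocks J)
        = (\<integral>\<^sup>+ x. indicator (\<Pi>\<^sub>E v\<in>J. {m v * y<..}) x \<partial>exponential_clocks J)"
      using J by (intro nn_integral_cong)
        (auto simp: indicator_def space_PiM PiE_def extensional_def Pi_def)
    also have "\<dots> = emeasure (exponential_clocks J) (\<Pi>\<^sub>E v\<in>J. {m v * y<..})"
      using J by (intro nn_integral_indicator sets_PiM_I_finite) auto
    also have "\<dots> = (\<Prod>v\<in>J. emeasure ?E {m v * y<..})"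
      using J by (intro exponential_clocks.emeasure_PiM) auto
    also have "\<dots> = (\<Prod>v\<in>J. ennreal (exp (- (m v * y))))"
      using m that by (intro prod.cong refl emeasure_exponential_greaterThan) auto
    also have "\<dots> = ennreal (\<Prod>v\<in>J. exp (- (m v * y)))"
      by (intro prod_ennreal) auto
    also have "(\<Prod>v\<in>J. exp (- (m v * y))) = exp (- (y * (\<Sum>v\<in>J. m v)))"
      using J(1) by (simp add: exp_sum[symmetric] sum_negf sum_distrib_left mult.commute)
    finally show ?thesis .
  qed
  have "emeasure (exponential_clocks (insert u J)) ?A
      = (\<integral>\<^sup>+ \<omega>. indicator ?A \<omega> \<partial>exponential_clocks (insert u J))"
    by simp
  also have "\<dots> = (\<integral>\<^sup>+ y. (\<integral>\<^sup>+ x. indicator ?A (x(u := y)) \<partial>exponential_clocks J) \<partial>?E)"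
    using J by (intro exponential_clocks.product_nn_integral_insert_rev) auto
  also have "\<dots> = (\<integral>\<^sup>+ y. exponential_density 1 y *
      (\<integral>\<^sup>+ x. indicator ?A (x(u := y)) \<partial>exponential_clocks J) \<partial>lborel)"
    by (intro nn_integral_density) auto
  \<comment> \<open>The integrand is, up to the factor \<open>inverse ?s\<close>, the exponential
    density of rate \<open>?s\<close>, whose total mass is 1. For \<open>y < 0\<close> both
    densities vanish, so \<open>inner\<close> is only called for \<open>y \<ge> 0\<close>.\<close>
  also have "\<dots> = (\<integral>\<^sup>+ y. ennreal (inverse ?s) * ennreal (exponential_density ?s y) \<partial>lborel)"
  proof (intro nn_integral_cong)
    fix y :: real
    show "exponential_density 1 y * (\<integral>\<^sup>+ x. indicator ?A (x(u := y)) \<partial>exponential_clocks J)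
      = ennreal (inverse ?s) * ennreal (exponential_density ?s y)"
    proof (cases "y < 0")
      case False
      have "exp (- y) * exp (- (y * (\<Sum>v\<in>J. m v))) = exp (- y * ?s)"
        by (simp add: exp_add[symmetric] algebra_simps)
      then have "exponential_density 1 y * exp (- (y * (\<Sum>v\<in>J. m v)))
          = inverse ?s * exponential_density ?s y"
        using s False by (simp add: exponential_density_def)
      then show ?thesis
        using False s by (simp add: inner ennreal_mult[symmetric] exponential_density_nonneg)
    qed (simp add: exponential_density_def[of _ y])
  qed
  also have "\<dots> = ennreal (inverse ?s) * emeasure (density lborel (exponential_density ?s)) UNIV"
    by (simp add: nn_integral_cmult emeasure_density)
  also have "emeasure (density lborel (exponential_density ?s)) UNIV = 1"
    using prob_space.emeasure_space_1[OF prob_space_exponential_density[OF s]] by simp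
  finally show ?thesis by simp
qed

text \<open>Continuity from above reduces the countable race to finite ones: the events
  \<open>A n\<close> decrease to the full event while the finite sums in their probabilities
  converge. The condition \<open>m u = 1\<close> supplies the summand 1 that belongs to
  \<open>u\<close> itself.\<close>

lemma measure_first_clock:
  fixes m :: "'u \<Rightarrow> real"
  assumes U: "countable U" "u \<in> U" and m: "m summable_on U" "\<And>v. v \<in> U \<Longrightarrow> m v \<ge> 0" "m u = 1"
  shows "\<P>(\<omega> in exponential_clocks U. \<forall>v\<in>U-{u}. m v * \<omega> u < \<omega> v) = inverse (\<Sum>\<^sub>\<infinity>v\<in>U. m v)"
proof -
  let ?Q = "exponential_clocks U"
  define F where "F n = {v \<in> U-{u}. to_nat_on U v \<le> n}" for n
  define A where "A n = {\<omega> \<in> space ?Q. \<forall>v\<in>F n. m v * \<omega> u < \<omega> v}" for n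
  have F: "finite (F n)" "F n \<subseteq> U - {u}" for n
  proof -
    have "F n \<subseteq> from_nat_into U ` {..n}"
    proof
      fix v assume "v \<in> F n"
      then show "v \<in> from_nat_into U ` {..n}"
        using U by (intro image_eqI[of _ _ "to_nat_on U v"]) (auto simp: F_def)
    qed
    then show "finite (F n)" by (rule finite_subset) simp
  qed (auto simp: F_def)
  have A_sets: "A n \<in> sets ?Q" for n
    using sets_clock_comparison[of "F n" U u m 1] F[of n] U
    by (auto simp: A_def intro: countable_finite)
  have A_measure: "measure ?Q (A n) = inverse (1 + (\<Sum>v\<in>F n. m v))" for n
  proof -
    let ?K = "insert u (F n)"
    let ?B = "{\<omega> \<in> space (exponential_clocks ?K). \<forall>v\<in>F n. m v * \<omega> u < \<omega> v}"
    have sB: "?B \<in> sets (exponential_clocks ?K)"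
      using F(1)[of n] by measurable
    have K: "?K \<subseteq> U" "finite ?K" using F[of n] U by auto
    \<comment> \<open>\<open>A n\<close> depends on finitely many coordinates only, so it is a
      cylinder and its measure can be computed in the finite product.\<close>
    have "A n = prod_emb U (\<lambda>_. density lborel (exponential_density 1)) ?K ?B"
      using K by (auto simp: A_def prod_emb_def space_PiM)
    then have "emeasure ?Q (A n) = emeasure (exponential_clocks ?K) ?B"
      using exponential_clocks.emeasure_PiM_emb'[OF K sB] by simp
    also have "\<dots> = ennreal (inverse (1 + (\<Sum>v\<in>F n. m v)))"
      using F[of n] m by (intro emeasure_first_clock_finite) auto
    finally show ?thesis
      using F[of n] m by (simp add: measure_def enn2real_ennreal add_nonneg_nonneg sum_nonneg subset_iff)
  qed
  have "(\<lambda>n. measure ?Q (A n)) \<longlonglongrightarrow> measure ?Q (\<Inter>n. A n)"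
    using A_sets by (intro exponential_clocks.P.finite_Lim_measure_decseq)
      (auto simp: decseq_def A_def F_def)
  moreover have "(\<Inter>n. A n) = {\<omega> \<in> space ?Q. \<forall>v\<in>U-{u}. m v * \<omega> u < \<omega> v}"
    by (auto simp: A_def F_def)
  moreover have "(\<lambda>n. measure ?Q (A n)) \<longlonglongrightarrow> inverse (1 + infsum m (U - {u}))"
  proof -
    have sum: "(m has_sum infsum m (U - {u})) (U - {u})"
      using m(1) by (intro has_sum_infsum) (rule summable_on_subset_banach, auto)
    \<comment> \<open>The stages \<open>F n\<close> eventually contain every finite subset of
      \<open>U - {u}\<close>; hence the unordered sum is the limit of the sums over them.\<close>
    have "filterlim F (finite_subsets_at_top (U - {u})) sequentially"
      unfolding filterlim_finite_subsets_at_top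
    proof (intro allI impI)
      fix Y assume Y: "finite Y \<and> Y \<subseteq> U - {u}"
      show "\<forall>\<^sub>F n in sequentially. finite (F n) \<and> Y \<subseteq> F n \<and> F n \<subseteq> U - {u}"
      proof (rule eventually_sequentiallyI)
        \<comment> \<open>Inserting 0 keeps the maximum meaningful for empty
          \<open>Y\<close>.\<close>
        fix n assume "Max (insert 0 (to_nat_on U ` Y)) \<le> n"
        then show "finite (F n) \<and> Y \<subseteq> F n \<and> F n \<subseteq> U - {u}"
          using F[of n] Y by (auto simp: F_def)
      qed
    qed
    from filterlim_compose[OF sum[unfolded has_sum_def] this]
    have "(\<lambda>n. sum m (F n)) \<longlonglongrightarrow> infsum m (U - {u})" .
    moreover have "1 + infsum m (U - {u}) \<noteq> 0"
      using infsum_nonneg[of "U - {u}" m] m(2) by force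
    ultimately show ?thesis unfolding A_measure by (intro tendsto_intros)
  qed
  moreover have "infsum m U = 1 + infsum m (U - {u})"
    using infsum_Un_disjoint[of m "{u}" "U - {u}"] U m summable_on_subset_banach[OF m(1), of "U - {u}"]
    by (simp add: insert_absorb)
  ultimately show ?thesis by (simp add: LIMSEQ_unique)
qed

section \<open>The event that a given clock rings first\<close>

lemma AE_exponential_clock_nonneg:
  assumes "u \<in> U"
  shows "AE \<omega> in exponential_clocks U. \<omega> u \<ge> 0"
proof (rule AE_PiM_component)
  show "AE t in density lborel (exponential_density 1). t \<ge> 0"
    by (subst AE_density) (auto simp: exponential_density_def)
qed (auto intro: assms exponential.prob_space_axioms)

text \<open>The clock of \<open>v\<close> rings at time \<open>\<omega> v / p v\<close>; the inequalities are multiplied out so that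
  clocks of rate \<open>0\<close> never ring, instead of ringing at time \<open>\<omega> v / 0 = 0\<close>.\<close>

definition first_ring :: "'u set \<Rightarrow> ('u \<Rightarrow> real) \<Rightarrow> 'u \<Rightarrow> ('u \<Rightarrow> real) set" where
  "first_ring U p u =
     {\<omega> \<in> space (exponential_clocks U). p u > 0 \<and> (\<forall>v\<in>U-{u}. p v * \<omega> u < p u * \<omega> v)}"

lemma first_ring_sets:
  assumes "countable U" "u \<in> U"
  shows "first_ring U p u \<in> sets (exponential_clocks U)"
  using sets_clock_comparison[of "U - {u}" U u p "p u"] assms
  by (cases "p u > 0") (simp_all add: first_ring_def)

text \<open>The inequalities are strict, so a tie has no winner, and two distinct winners would each
  have to beat the other.\<close>

lemma first_ring_unique:
  assumes "\<omega> \<in> first_ring U p u" "\<omega> \<in> first_ring U p w" "u \<in> U" "w \<in> U"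
  shows "u = w"
proof (rule ccontr)
  assume "u \<noteq> w"
  then have "p w * \<omega> u < p u * \<omega> w" "p u * \<omega> w < p w * \<omega> u"
    using assms by (auto simp: first_ring_def)
  then show False by simp
qed

text \<open>Winning both races against \<open>v\<close> means beating \<open>v\<close> at the larger
  of its two relative rates. The intersection is thus almost surely a single race with rates
  \<open>?m\<close>, to which \<open>measure_first_clock\<close> applies.\<close>

lemma measure_first_ring_Int:
  fixes p q :: "'u \<Rightarrow> real"
  assumes U: "countable U" "u \<in> U"
    and p: "p summable_on U" "\<And>v. p v \<ge> 0" and q: "q summable_on U" "\<And>v. q v \<ge> 0"
  shows "measure (exponential_clocks U) (first_ring U p u \<inter> first_ring U q u) = agreement_term U p q u"
proof (cases "p u = 0 \<or> q u = 0")
  case True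
  then have "first_ring U p u \<inter> first_ring U q u = {}" by (auto simp: first_ring_def)
  then show ?thesis using True by (simp add: agreement_term_def)
next
  case False
  then have pos: "p u > 0" "q u > 0" using p(2)[of u] q(2)[of u] by auto
  let ?Q = "exponential_clocks U" and ?m = "\<lambda>v. max (p v / p u) (q v / q u)"
  let ?p = "\<lambda>v. p v / p u" and ?q = "\<lambda>v. q v / q u"
  \<comment> \<open>Multiplication by \<open>x\<close> distributes over the maximum only for
    \<open>x \<ge> 0\<close>. Clocks range over all reals in the product space, which is why the two
    events below agree only almost everywhere.\<close>
  have max_less: "?m v * x < y \<longleftrightarrow> p v * x < p u * y \<and> q v * x < q u * y" if "x \<ge> 0" for v x y
  proof -
    have "?m v * x = max (?p v * x) (?q v * x)"
      using that by (simp add: max_mult_distrib_right)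
    then show ?thesis using pos by (simp add: field_simps)
  qed
  have "measure ?Q (first_ring U p u \<inter> first_ring U q u)
      = \<P>(\<omega> in ?Q. \<forall>v\<in>U-{u}. ?m v * \<omega> u < \<omega> v)"
  proof (rule measure_eq_AE)
    show "AE \<omega> in ?Q. \<omega> \<in> first_ring U p u \<inter> first_ring U q u \<longleftrightarrow>
        \<omega> \<in> {\<omega> \<in> space ?Q. \<forall>v\<in>U-{u}. ?m v * \<omega> u < \<omega> v}"
      using AE_exponential_clock_nonneg[OF U(2)]
      by eventually_elim (use pos in \<open>auto simp: first_ring_def max_less\<close>)
    show "first_ring U p u \<inter> first_ring U q u \<in> sets ?Q"
      using U by (intro sets.Int first_ring_sets)
    \<comment> \<open>Because of this normalisation the single race is itself a
      \<open>first_ring\<close> event, for the rates \<open>?m\<close>, and inherits its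
      measurability.\<close>
    have "?m u = 1" using pos by simp
    then have "{\<omega> \<in> space ?Q. \<forall>v\<in>U-{u}. ?m v * \<omega> u < \<omega> v} = first_ring U ?m u"
      by (simp add: first_ring_def)
    then show "{\<omega> \<in> space ?Q. \<forall>v\<in>U-{u}. ?m v * \<omega> u < \<omega> v} \<in> sets ?Q"
      using first_ring_sets[OF U] by simp
  qed
  also have "\<dots> = inverse (\<Sum>\<^sub>\<infinity>v\<in>U. ?m v)"
    using U p q pos
    by (intro measure_first_clock summable_on_max_ratio) (auto simp: le_max_iff_disj)
  finally show ?thesis using False by (simp add: agreement_term_def)
qed

section \<open>The winner as a random variable: law and agreement\<close>

lemma agreement_term_self:
  assumes "(p has_sum 1) U"
  shows "agreement_term U p p u = p u"
proof (cases "p u = 0")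
  case False
  \<comment> \<open>For equal arguments both ratios in the maximum coincide, so the inner sum is
    total mass 1 divided by \<open>p u\<close>.\<close>
  have "((\<lambda>v. p v / p u) has_sum 1 / p u) U"
    unfolding divide_inverse by (intro has_sum_cmult_left assms)
  from infsumI[OF this] show ?thesis using False by (simp add: agreement_term_def)
qed (simp add: agreement_term_def)

text \<open>The default value is only taken on a null set, see \<open>AE_first_ring\<close> below.\<close>

definition first_clock :: "'u set \<Rightarrow> ('u \<Rightarrow> real) \<Rightarrow> ('u \<Rightarrow> real) \<Rightarrow> 'u" where
  "first_clock U p \<omega> =
     (if \<exists>u\<in>U. \<omega> \<in> first_ring U p u then THE u. u \<in> U \<and> \<omega> \<in> first_ring U p u
      else SOME u. u \<in> U)"

lemma first_clock_eq:
  assumes "\<omega> \<in> first_ring U p u" "u \<in> U"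
  shows "first_clock U p \<omega> = u"
  unfolding first_clock_def using assms first_ring_unique[of \<omega> U p] by (auto intro!: the_equality)

text \<open>Since \<open>U\<close> is countable, preimages of points suffice. Each is a
  \<open>first_ring\<close> event, except that the default point also receives all outcomes without
  a winner.\<close>

lemma measurable_first_clock:
  assumes "countable U" "U \<noteq> {}"
  shows "first_clock U p \<in> exponential_clocks U \<rightarrow>\<^sub>M count_space U"
  unfolding measurable_count_space_eq_countable[OF assms(1)]
proof (intro conjI ballI funcsetI)
  let ?Q = "exponential_clocks U"
  have default: "(SOME u. u \<in> U) \<in> U" using assms(2) by (simp add: some_in_eq)
  show "first_clock U p \<omega> \<in> U" for \<omega>
  proof (cases "\<exists>u\<in>U. \<omega> \<in> first_ring U p u")
    case True
    then show ?thesis using first_clock_eq[of \<omega> U p] by auto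
  qed (use default in \<open>auto simp: first_clock_def\<close>)
  fix a assume a: "a \<in> U"
  let ?N = "space ?Q - (\<Union>u\<in>U. first_ring U p u)"
  have "first_clock U p -` {a} \<inter> space ?Q =
      first_ring U p a \<union> (if a = (SOME u. u \<in> U) then ?N else {})"
  proof (intro set_eqI)
    fix \<omega>
    show "\<omega> \<in> first_clock U p -` {a} \<inter> space ?Q \<longleftrightarrow>
        \<omega> \<in> first_ring U p a \<union> (if a = (SOME u. u \<in> U) then ?N else {})"
    proof (cases "\<exists>u\<in>U. \<omega> \<in> first_ring U p u")
      case True
      then obtain u where u: "u \<in> U" "\<omega> \<in> first_ring U p u" by blast
      moreover from u have "\<omega> \<in> space ?Q" by (simp add: first_ring_def)
      ultimately show ?thesis
        using first_clock_eq[of \<omega> U p u] first_ring_unique[of \<omega> U p u a] a by auto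
    qed (use a in \<open>auto simp: first_clock_def\<close>)
  qed
  also have "\<dots> \<in> sets ?Q"
    using assms a by (auto intro!: sets.Un sets.Diff sets.countable_UN'' first_ring_sets)
  finally show "first_clock U p -` {a} \<inter> space ?Q \<in> sets ?Q" .
qed

text \<open>No Borel-Cantelli argument is needed: the disjoint events that \<open>u\<close> rings first have total
  probability \<open>\<Sum> p u = 1\<close>.\<close>

lemma AE_first_ring:
  assumes U: "countable U" and p: "(p has_sum 1) U" "\<And>v. p v \<ge> 0"
  shows "AE \<omega> in exponential_clocks U. \<exists>u\<in>U. \<omega> \<in> first_ring U p u"
proof -
  let ?Q = "exponential_clocks U" and ?R = "\<Union>u\<in>U. first_ring U p u"
  have "((\<lambda>u. measure ?Q (first_ring U p u)) has_sum measure ?Q ?R) U"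
    using U by (intro exponential_clocks.P.has_sum_measure_disjoint_UN first_ring_sets)
      (auto simp: disjoint_family_on_def dest: first_ring_unique)
  also have "?this \<longleftrightarrow> (p has_sum measure ?Q ?R) U"
  proof (intro has_sum_cong)
    fix u assume "u \<in> U"
    then show "measure ?Q (first_ring U p u) = p u"
      using measure_first_ring_Int[OF U, of u p p] p agreement_term_self[OF p(1), of u]
      by (simp add: has_sum_imp_summable)
  qed
  finally have "measure ?Q ?R = 1" using p(1) has_sum_unique by blast
  moreover have "?R \<in> sets ?Q" using U by (intro sets.countable_UN'' first_ring_sets) auto
  ultimately have "AE \<omega> in ?Q. \<omega> \<in> ?R" by (simp add: exponential_clocks.P.prob_eq_1)
  then show ?thesis by simp
qed

text \<open>Outside a null set both races have a winner in \<open>U\<close>, so the default never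
  enters and each \<open>first_clock\<close> equals \<open>u\<close> exactly when \<open>u\<close>
  wins the corresponding race.\<close>

lemma prob_first_clock_joint:
  assumes U: "countable U" "u \<in> U" and p: "(p has_sum 1) U" "\<And>v. p v \<ge> 0"
    and q: "(q has_sum 1) U" "\<And>v. q v \<ge> 0"
  shows "\<P>(\<omega> in exponential_clocks U. first_clock U p \<omega> = u \<and> first_clock U q \<omega> = u) =
    agreement_term U p q u"
proof -
  let ?Q = "exponential_clocks U"
  have "\<P>(\<omega> in ?Q. first_clock U p \<omega> = u \<and> first_clock U q \<omega> = u)
      = measure ?Q (first_ring U p u \<inter> first_ring U q u)"
  proof (rule measure_eq_AE)
    show "AE \<omega> in ?Q. \<omega> \<in> {\<omega> \<in> space ?Q. first_clock U p \<omega> = u \<and> first_clock U q \<omega> = u} \<longleftrightarrow>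
        \<omega> \<in> first_ring U p u \<inter> first_ring U q u"
      using AE_first_ring[OF U(1) p] AE_first_ring[OF U(1) q]
    proof eventually_elim
      case (elim \<omega>)
      then obtain v w where "v \<in> U" "\<omega> \<in> first_ring U p v" "w \<in> U" "\<omega> \<in> first_ring U q w" by blast
      then have "\<omega> \<in> first_ring U p u \<longleftrightarrow> first_clock U p \<omega> = u"
        and "\<omega> \<in> first_ring U q u \<longleftrightarrow> first_clock U q \<omega> = u"
        using first_clock_eq U(2) by metis+
      moreover have "\<omega> \<in> space ?Q"
        using \<open>\<omega> \<in> first_ring U p v\<close> by (simp add: first_ring_def)
      ultimately show ?case by simp
    qed
    have "{\<omega> \<in> space ?Q. first_clock U p \<omega> = u \<and> first_clock U q \<omega> = u} =
        (first_clock U p -` {u} \<inter> space ?Q) \<inter> (first_clock U q -` {u} \<inter> space ?Q)" by auto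
    also have "\<dots> \<in> sets ?Q" using U by (intro sets.Int measurable_sets) (auto intro: measurable_first_clock)
    finally show "{\<omega> \<in> space ?Q. first_clock U p \<omega> = u \<and> first_clock U q \<omega> = u} \<in> sets ?Q" .
    show "first_ring U p u \<inter> first_ring U q u \<in> sets ?Q"
      using U by (intro sets.Int first_ring_sets)
  qed
  then show ?thesis
    using measure_first_ring_Int[OF U] p q by (simp add: has_sum_imp_summable)
qed

lemma prob_first_clock:
  assumes "countable U" "u \<in> U" "(p has_sum 1) U" "\<And>v. p v \<ge> 0"
  shows "\<P>(\<omega> in exponential_clocks U. first_clock U p \<omega> = u) = p u"
  using prob_first_clock_joint[of U u p p] agreement_term_self[of p U u] assms by simp

lemma prob_first_clock_agree:
  assumes U: "countable U" "U \<noteq> {}" and p: "(p has_sum 1) U" "\<And>v. p v \<ge> 0"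
    and q: "(q has_sum 1) U" "\<And>v. q v \<ge> 0"
  shows "\<P>(\<omega> in exponential_clocks U. first_clock U p \<omega> = first_clock U q \<omega>) =
    (\<Sum>\<^sub>\<infinity>u\<in>U. agreement_term U p q u)"
proof -
  let ?Q = "exponential_clocks U"
  let ?A = "\<lambda>u. {\<omega> \<in> space ?Q. first_clock U p \<omega> = u \<and> first_clock U q \<omega> = u}"
  have meas: "first_clock U r \<in> ?Q \<rightarrow>\<^sub>M count_space U" for r
    using U by (rule measurable_first_clock)
  have "((\<lambda>u. measure ?Q (?A u)) has_sum measure ?Q (\<Union>u\<in>U. ?A u)) U"
  proof (intro exponential_clocks.P.has_sum_measure_disjoint_UN U)
    fix u assume "u \<in> U"
    have "?A u = (first_clock U p -` {u} \<inter> space ?Q) \<inter> (first_clock U q -` {u} \<inter> space ?Q)" by auto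
    also have "\<dots> \<in> sets ?Q" using \<open>u \<in> U\<close> by (intro sets.Int measurable_sets[OF meas]) auto
    finally show "?A u \<in> sets ?Q" .
  qed (auto simp: disjoint_family_on_def)
  also have "(\<Union>u\<in>U. ?A u) = {\<omega> \<in> space ?Q. first_clock U p \<omega> = first_clock U q \<omega>}"
    using measurable_space[OF meas] by auto
  finally have "\<P>(\<omega> in ?Q. first_clock U p \<omega> = first_clock U q \<omega>) = (\<Sum>\<^sub>\<infinity>u\<in>U. measure ?Q (?A u))"
    by (simp add: infsumI)
  also have "\<dots> = (\<Sum>\<^sub>\<infinity>u\<in>U. agreement_term U p q u)"
    using assms by (intro infsum_cong prob_first_clock_joint)
  finally show ?thesis .
qed

subsection \<open>The coupling and the total variation bound\<close>

lemma exists_exponential_coupling: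
  fixes U :: "'u set" and I :: "'i set"
    and M :: "'i \<Rightarrow> 'a measure" and X :: "'i \<Rightarrow> 'a \<Rightarrow> 'u"
  assumes U: "countable U"
    and M: "\<And>i. i \<in> I \<Longrightarrow> prob_space (M i)"
    and X: "\<And>i. i \<in> I \<Longrightarrow> X i \<in> M i \<rightarrow>\<^sub>M count_space U"
  shows "\<exists>(N :: ('i \<Rightarrow> 'u) measure) X'.
            is_coupling I (count_space U) M X N X' \<and>
            (\<forall>i\<in>I. \<forall>j\<in>I.
               \<P>(\<omega> in N. X' i \<omega> = X' j \<omega>) = agreement_sum U (M i) (X i) (M j) (X j))"
proof -
  let ?Q = "exponential_clocks U"
  define p where "p i v = \<P>(\<omega> in M i. X i \<omega> = v)" for i v
  \<comment> \<open>All variables read the same clocks. The joint law of the winners is pushed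
    forward to the product of copies of \<open>U\<close>, where the coordinate projections serve as
    the coupled variables. Measurability of \<open>Y\<close> is checked one coordinate at a time, so
    \<open>I\<close> may be uncountable.\<close>
  define Y where "Y \<omega> = (\<lambda>i\<in>I. first_clock U (p i) \<omega>)" for \<omega>
  define N where "N = distr ?Q (\<Pi>\<^sub>M i\<in>I. count_space U) Y"
  \<comment> \<open>A probability space has a point, and \<open>X i\<close> maps it into
    \<open>U\<close>; this makes the default value of \<open>first_clock\<close> an element of
    \<open>U\<close>.\<close>
  have ne: "U \<noteq> {}" if "i \<in> I" for i
    using prob_space.not_empty[OF M[OF that]] measurable_space[OF X[OF that]] by auto
  have p: "(p i has_sum 1) U" if "i \<in> I" for i
  proof -
    have "\<P>(\<omega> in M i. X i \<omega> \<in> U) = 1"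
      using prob_space.prob_space[OF M[OF that]] measurable_space[OF X[OF that]]
      by (simp cong: conj_cong)
    then show ?thesis
      using has_sum_point_probabilities[OF M[OF that] X[OF that] subset_refl U]
      by (simp add: p_def[abs_def])
  qed
  have p0: "p i v \<ge> 0" for i v by (simp add: p_def)
  have fc: "first_clock U (p i) \<in> ?Q \<rightarrow>\<^sub>M count_space U" if "i \<in> I" for i
    using U ne[OF that] by (rule measurable_first_clock)
  have Y: "Y \<in> ?Q \<rightarrow>\<^sub>M (\<Pi>\<^sub>M i\<in>I. count_space U)"
    unfolding Y_def using fc by (rule measurable_restrict)
  have N: "prob_space N"
    unfolding N_def using Y by (rule exponential_clocks.P.prob_space_distr)
  have comp: "(\<lambda>f. f i) \<in> N \<rightarrow>\<^sub>M count_space U" if "i \<in> I" for i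
    using measurable_component_singleton[OF that, of "\<lambda>_. count_space U"] by (simp add: N_def)
  have law: "distr N (count_space U) (\<lambda>f. f i) = distr (M i) (count_space U) (X i)" if i: "i \<in> I" for i
  proof (rule measure_eqI_countable[OF _ _ U])
    fix u assume u: "u \<in> U"
    have "distr N (count_space U) (\<lambda>f. f i) = distr ?Q (count_space U) ((\<lambda>f. f i) \<circ> Y)"
      unfolding N_def by (intro distr_distr measurable_component_singleton i Y)
    also have "(\<lambda>f. f i) \<circ> Y = first_clock U (p i)" using i by (auto simp: Y_def)
    also have "emeasure (distr ?Q (count_space U) (first_clock U (p i))) {u} =
        emeasure ?Q {\<omega> \<in> space ?Q. first_clock U (p i) \<omega> = u}"
      using fc[OF i] u by (subst emeasure_distr) (auto intro!: arg_cong[where f = "emeasure ?Q"])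
    also have "\<dots> = ennreal (p i u)"
      using prob_first_clock[OF U u p[OF i] p0] by (simp add: exponential_clocks.P.emeasure_eq_measure)
    also have "\<dots> = emeasure (M i) {\<omega> \<in> space (M i). X i \<omega> = u}"
      using finite_measure.emeasure_eq_measure[OF prob_space.finite_measure[OF M[OF i]]]
      by (simp add: p_def)
    also have "\<dots> = emeasure (distr (M i) (count_space U) (X i)) {u}"
      using X[OF i] u by (subst emeasure_distr) (auto intro!: arg_cong[where f = "emeasure (M i)"])
    finally show "emeasure (distr N (count_space U) (\<lambda>f. f i)) {u} =
        emeasure (distr (M i) (count_space U) (X i)) {u}" .
  qed auto
  have agree: "\<P>(f in N. f i = f j) = agreement_sum U (M i) (X i) (M j) (X j)"
    if ij: "i \<in> I" "j \<in> I" for i j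
  proof -
    let ?D = "{f \<in> space N. f i = f j}"
    \<comment> \<open>Countability of \<open>U\<close> makes agreement of two coordinates an event:
      it is split by the common value.\<close>
    have "?D = (\<Union>u\<in>U. ((\<lambda>f. f i) -` {u} \<inter> space N) \<inter> ((\<lambda>f. f j) -` {u} \<inter> space N))"
      using measurable_space[OF comp] ij by auto
    also have "\<dots> \<in> sets N"
      by (intro sets.countable_UN'' U sets.Int measurable_sets[OF comp] ij) auto
    finally have D: "?D \<in> sets (\<Pi>\<^sub>M i\<in>I. count_space U)" by (simp add: N_def)
    have "measure N ?D = measure ?Q (Y -` ?D \<inter> space ?Q)"
      unfolding N_def by (rule measure_distr[OF Y]) (use D in \<open>simp add: N_def\<close>)
    also have "Y -` ?D \<inter> space ?Q =
        {\<omega> \<in> space ?Q. first_clock U (p i) \<omega> = first_clock U (p j) \<omega>}"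
      using ij measurable_space[OF Y] by (auto simp: N_def Y_def)
    also have "measure ?Q \<dots> = (\<Sum>\<^sub>\<infinity>u\<in>U. agreement_term U (p i) (p j) u)"
      by (intro prob_first_clock_agree U ne[OF ij(1)] p ij p0)
    finally show ?thesis by (simp add: agreement_sum_def p_def[abs_def])
  qed
  show ?thesis
    by (rule exI[of _ N], rule exI[of _ "\<lambda>i f. f i"])
      (auto simp: is_coupling_def N comp law agree)
qed

text \<open>The inner sum is at most \<open>\<Sum> max (p v) (q v) / min (p u) (q u) = (1 + D) / min (p u) (q u)\<close> for the
  excess mass \<open>D\<close> of \<open>p\<close> over \<open>q\<close>, and \<open>\<Sum> min (p u) (q u) = 1 - D\<close>.\<close>

lemma agreement_sum_ge:
  assumes U: "countable U"
    and "prob_space M" and X: "X \<in> M \<rightarrow>\<^sub>M count_space U"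
    and "prob_space N" and Y: "Y \<in> N \<rightarrow>\<^sub>M count_space U"
  shows "agreement_sum U M X N Y \<ge> 1 - F_bound (tv_dist (count_space U) M X N Y)"
proof -
  interpret M: prob_space M by fact
  interpret N: prob_space N by fact
  define p where "p v = \<P>(\<omega> in M. X \<omega> = v)" for v
  define q where "q v = \<P>(\<omega> in N. Y \<omega> = v)" for v
  \<comment> \<open>The set where \<open>p\<close> dominates \<open>q\<close> makes the signed
    difference of the two laws largest; used as a test event in the supremum it gives
    \<open>D \<le> t\<close>.\<close>
  define A where "A = {v\<in>U. p v \<ge> q v}"
  define t where "t = tv_dist (count_space U) M X N Y"
  define D where "D = \<P>(\<omega> in M. X \<omega> \<in> A) - \<P>(\<omega> in N. Y \<omega> \<in> A)"
  have p0: "p v \<ge> 0" and q0: "q v \<ge> 0" for v by (simp_all add: p_def q_def)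
  have pB: "(p has_sum \<P>(\<omega> in M. X \<omega> \<in> B)) B" and qB: "(q has_sum \<P>(\<omega> in N. Y \<omega> \<in> B)) B"
    if "B \<subseteq> U" for B
    using has_sum_point_probabilities[OF \<open>prob_space M\<close> X that countable_subset[OF that U]]
      has_sum_point_probabilities[OF \<open>prob_space N\<close> Y that countable_subset[OF that U]]
    by (simp_all add: p_def[abs_def] q_def[abs_def])
  have p1: "(p has_sum 1) U" and q1: "(q has_sum 1) U"
    using pB[of U] qB[of U] M.prob_space N.prob_space measurable_space[OF X] measurable_space[OF Y]
    by (simp_all cong: conj_cong)
  have diff: "((\<lambda>v. max 0 (p v - q v)) has_sum D) U"
  proof -
    have "((\<lambda>v. p v - q v) has_sum D) A"
      unfolding D_def by (intro has_sum_diff pB qB) (auto simp: A_def)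
    also have "?this \<longleftrightarrow> ?thesis" by (intro has_sum_cong_neutral) (auto simp: A_def)
    finally show ?thesis .
  qed
  have "D \<ge> 0" by (rule has_sum_nonneg[OF diff]) simp
  have "D \<le> t"
  proof -
    have "\<bar>\<P>(\<omega> in M. X \<omega> \<in> A) - \<P>(\<omega> in N. Y \<omega> \<in> A)\<bar> \<le> t"
      unfolding t_def tv_dist_def
    proof (rule cSUP_upper)
      \<comment> \<open>A supremum of reals bounds its members only when the family is bounded
        above, here by 1.\<close>
      have "\<bar>x - y\<bar> \<le> 1" if "0 \<le> x" "x \<le> 1" "0 \<le> y" "y \<le> 1" for x y :: real using that by linarith
      then show "bdd_above ((\<lambda>A. \<bar>\<P>(\<omega> in M. X \<omega> \<in> A) - \<P>(\<omega> in N. Y \<omega> \<in> A)\<bar>) ` sets (count_space U))"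
        by (intro bdd_aboveI[of _ 1]) auto
    qed (auto simp: A_def)
    then show ?thesis by (simp add: D_def)
  qed
  \<comment> \<open>Pointwise, the maximum is \<open>q\<close> plus the excess
    \<open>max 0 (p v - q v)\<close>, and the minimum is \<open>p\<close> minus that excess.\<close>
  have max_sum: "((\<lambda>v. max (p v) (q v)) has_sum (1 + D)) U"
    using has_sum_add[OF q1 diff] by (rule has_sum_cong[THEN iffD1, rotated]) (simp add: max_def)
  have min_sum: "((\<lambda>v. min (p v) (q v)) has_sum (1 - D)) U"
    using has_sum_diff[OF p1 diff] by (rule has_sum_cong[THEN iffD1, rotated]) (simp add: max_def min_def)
  have le: "min (p u) (q u) * inverse (1 + D) \<le> agreement_term U p q u" for u
  proof (cases "p u = 0 \<or> q u = 0")
    case True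
    then show ?thesis using p0[of u] q0[of u] by (auto simp: agreement_term_def)
  next
    case False
    then have pos: "p u > 0" "q u > 0" using p0[of u] q0[of u] by auto
    let ?m = "\<lambda>v. max (p v / p u) (q v / q u)" and ?c = "min (p u) (q u)"
    have s: "?m summable_on U"
      using p1 q1 p0 q0 by (intro summable_on_max_ratio) (auto simp: has_sum_imp_summable)
    have mono: "?m v \<le> max (p v) (q v) * inverse ?c" for v
    proof -
      have "p v / p u \<le> max (p v) (q v) / ?c" "q v / q u \<le> max (p v) (q v) / ?c"
        using pos p0[of v] q0[of v] by (intro frac_le; simp add: le_max_iff_disj)+
      then show ?thesis by (simp add: divide_inverse)
    qed
    have "infsum ?m U \<le> (1 + D) * inverse ?c"
      by (rule has_sum_mono[OF has_sum_infsum[OF s] has_sum_cmult_left[OF max_sum] mono])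
    \<comment> \<open>Inverting the upper bound requires a positive inner sum; it is at least
      \<open>\<Sum> p v / p u = 1 / p u\<close>.\<close>
    moreover have "infsum ?m U > 0"
    proof -
      have "((\<lambda>v. p v * inverse (p u)) has_sum 1 * inverse (p u)) U"
        by (rule has_sum_cmult_left[OF p1])
      then have "1 * inverse (p u) \<le> infsum ?m U"
        by (rule has_sum_mono[OF _ has_sum_infsum[OF s]]) (simp add: divide_inverse)
      then show ?thesis using pos(1) by (smt (verit) positive_imp_inverse_positive)
    qed
    ultimately have "inverse ((1 + D) * inverse ?c) \<le> inverse (infsum ?m U)"
      by (rule le_imp_inverse_le)
    then show ?thesis using False by (simp add: agreement_term_def mult.commute)
  qed
  have s: "agreement_term U p q summable_on U"
    using p1 q1 p0 q0 by (intro summable_on_agreement_term) (auto simp: has_sum_imp_summable)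
  \<comment> \<open>The function \<open>(1 - x) / (1 + x)\<close> decreases for
    \<open>x \<ge> 0\<close>, so \<open>D \<le> t\<close> turns the bound in terms of
    \<open>D\<close> into the one in terms of \<open>t\<close>.\<close>
  have "1 - F_bound t = (1 - t) / (1 + t)"
    using \<open>D \<ge> 0\<close> \<open>D \<le> t\<close> by (simp add: F_bound_def field_simps)
  also have "\<dots> \<le> (1 - D) * inverse (1 + D)"
    using \<open>D \<ge> 0\<close> \<open>D \<le> t\<close> by (simp add: field_simps)
  also have "\<dots> \<le> infsum (agreement_term U p q) U"
    by (rule has_sum_mono[OF has_sum_cmult_left[OF min_sum] has_sum_infsum[OF s] le])
  also have "\<dots> = agreement_sum U M X N Y"
    by (simp add: agreement_sum_def p_def[abs_def] q_def[abs_def])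
  finally show ?thesis by (simp add: t_def)
qed

theorem proposition6:
  fixes U :: "'u set" and I :: "'i set"
    and M :: "'i \<Rightarrow> 'a measure" and X :: "'i \<Rightarrow> 'a \<Rightarrow> 'u"
  assumes "countable U"
    and "\<And>i. i \<in> I \<Longrightarrow> prob_space (M i)"
    and "\<And>i. i \<in> I \<Longrightarrow> X i \<in> M i \<rightarrow>\<^sub>M count_space U"
  shows "(\<exists>(N :: ('i \<Rightarrow> 'u) measure) X'.
            is_coupling I (count_space U) M X N X' \<and>
            (\<forall>i\<in>I. \<forall>j\<in>I.
               \<P>(\<omega> in N. X' i \<omega> = X' j \<omega>) = agreement_sum U (M i) (X i) (M j) (X j))) \<and>
         (\<forall>i\<in>I. \<forall>j\<in>I.
            agreement_sum U (M i) (X i) (M j) (X j)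
              \<ge> 1 - F_bound (tv_dist (count_space U) (M i) (X i) (M j) (X j)))"
proof (intro conjI ballI)
  show "\<exists>(N :: ('i \<Rightarrow> 'u) measure) X'.
            is_coupling I (count_space U) M X N X' \<and>
            (\<forall>i\<in>I. \<forall>j\<in>I.
               \<P>(\<omega> in N. X' i \<omega> = X' j \<omega>) = agreement_sum U (M i) (X i) (M j) (X j))"
    using assms by (rule exists_exponential_coupling)
qed (intro agreement_sum_ge assms)

end
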